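(* Consider $N\ge3$ robotic agents rigidly grasping an object, i.e. a motion of the coupled object-agents system on a time interval satisfying the agent dynamics $M\dot v+Cv+g=u-h$, the object dynamics $M_O\dot v_O+C_Ov_O+g_O=h_O$, the grasp rigidity relation $v=G^\top v_O$ and the force relation $h_O=Gh$. Here $h\in\mathbb{R}^{6N}$ is the stacked vector of agent forces exerted at the grasping points. Suppose that the configurations $x$ along the motion are nondegenerate. Let the internal forces be $$h_{\mathrm{int}}=M^{\frac12}\left(\mathcal{R}_{\mathcal{G}}M^{-\frac12}\right)^\dagger\left(\dot{\mathcal{R}}_{\mathcal{G}}v+\mathcal{R}_{\mathcal{G}}\alpha\right),\qquad \alpha=M^{-1}(u-Cv-g),$$ where $\mathcal{R}_{\mathcal{G}}$ is the distance-and-bearing rigidity matrix of the agents' framework on the complete graph $\mathcal{G}=\mathcal{K}_N$. Then $$h_{\mathrm{int}}=\left(I_{6N}-MG^\top(GMG^\top)^{-1}G\right)h .$$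
   Context: For $a\in\mathbb{R}^3$, $S(a)$ is the skew-symmetric matrix with $S(a)b=a\times b$; for nonzero $y\in\mathbb{R}^n$, $P_r(y)=I_n-\frac{yy^\top}{\|y\|^2}$; $A^\dagger$ is the Moore-Penrose inverse. Kinematics: agent $i\in\{1,\dots,N\}$ has end-effector position $p_i\in\mathbb{R}^3$, orientation $R_i\in\mathsf{SO}(3)$ and velocity $v_i=[\dot p_i^\top,\omega_i^\top]^\top$ with $\dot R_i=S(\omega_i)R_i$; $x=((p_1,R_1),\dots,(p_N,R_N))\in\mathsf{SE}(3)^N$ and $v=[v_1^\top,\dots,v_N^\top]^\top\in\mathbb{R}^{6N}$. The object's center of mass has position $p_O\in\mathbb{R}^3$, orientation $R_O\in\mathsf{SO}(3)$ and velocity $v_O=[\dot p_O^\top,\omega_O^\top]^\top\in\mathbb{R}^6$ with $\dot R_O=S(\omega_O)R_O$. Grasp matrix: $G=G(x)=[J_{O_1}^\top,\dots,J_{O_N}^\top]\in\mathbb{R}^{6\times6N}$ with $J_{O_i}=\begin{bmatrix} I_3 & -S(p_i-p_O)\\ 0_{3\times3}& I_3\end{bmatrix}$; it has full row rank. Dynamics: $M=M(x)\in\mathbb{R}^{6N\times6N}$ is the symmetric positive definite (block-diagonal) agent inertia matrix, $C\in\mathbb{R}^{6N\times6N}$ the agent Coriolis matrix, $g\in\mathbb{R}^{6N}$ the agent gravity vector, $u\in\mathbb{R}^{6N}$ the task-space input; $M_O\in\mathbb{R}^{6\times6}$ is the symmetric positive definite object inertia matrix, $C_O\in\mathbb{R}^{6\times6}$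 the object Coriolis matrix, $g_O\in\mathbb{R}^6$ the object gravity vector, $h_O\in\mathbb{R}^6$ the generalized force on the object's center of mass. All these depend on the state; arguments are omitted. Rigidity matrix: configurations have pairwise distinct positions. The complete graph $\mathcal{K}_N$ has edge set $\mathcal{E}=\{(i,j): i\ne j\}$, and $\mathcal{E}_u=\{(i,j)\in\mathcal{E}: i<j\}$. With $\gamma_{e,b}=R_i^\top\frac{p_j-p_i}{\|p_i-p_j\|}$ for $e=(i,j)$, the matrix $\mathcal{R}_{\mathcal{G}}(x)\in\mathbb{R}^{(|\mathcal{E}_u|+3|\mathcal{E}|)\times6N}$ has columns grouped in $N$ blocks of six (three for $\dot p_k$, then three for $\omega_k$). For each $e=(i,j)\in\mathcal{E}_u$ it has one row with block $i$ equal to $[(p_i-p_j)^\top\ 0_{1\times3}]$, block $j$ equal to $[(p_j-p_i)^\top\ 0_{1\times3}]$ and other blocks zero. For each $e=(i,j)\in\mathcal{E}$ it has three rows with block $i$ equal to $\left[-\frac{P_r(\gamma_{e,b})}{\|p_j-p_i\|}R_i^\top\ \ S(\gamma_{e,b})R_i^\top\right]$, block $j$ equal to $\left[\frac{P_r(\gamma_{e,b})}{\|p_j-p_i\|}R_i^\top\ \ 0_{3\times3}\right]$ and other blocks zero. (So $\mathcal{R}_{\mathcal{G}}v$ is the time derivative of the stacked squared half-distances $\frac12\|p_i-p_j\|^2$ and local bearings $\gamma_{e,b}$.) $\dot{\mathcal{R}}_{\mathcal{G}}$ is the time derivative of $\mathcal{R}_{\mathcal{G}}(x(t))$ along the motion.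 Nondegenerate: $\mathrm{rank}(\mathcal{R}_{\mathcal{G}}(x))=\max_y\mathrm{rank}(\mathcal{R}_{\mathcal{G}}(y))$, the maximum being over all $y\in\mathsf{SE}(3)^N$ with pairwise distinct positions. *)

theory Defs
  imports "HOL-Analysis.Analysis"
begin

text \<open>
  The six coordinates of a twist or wrench are indexed by \<open>3 + 3\<close>: \<open>Inl\<close> is the linear and \<open>Inr\<close> the
  angular part. The agents are the elements of a finite linearly ordered type \<open>'n\<close>, so that stacked
  vectors in $R^{6N}$ have index type \<open>'n \<times> (3 + 3)\<close>, and \<open>(i, k)\<close> is coordinate \<open>k\<close> of agent \<open>i\<close>.
  The sort \<open>card2\<close> (at least two elements) is only there to make the edge types nonempty.
\<close>

type_synonym six = "3 + 3"
type_synonym pose = "(real^3) \<times> (real^3^3)"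
type_synonym 'n config = "'n \<Rightarrow> pose"


subsection \<open>Matrices\<close>

definition sym_pos_def :: "real^'m^'m \<Rightarrow> bool" where
  "sym_pos_def A \<longleftrightarrow> transpose A = A \<and> (\<forall>y. y \<noteq> 0 \<longrightarrow> y \<bullet> (A *v y) > 0)"

definition sym_pos_semidef :: "real^'m^'m \<Rightarrow> bool" where
  "sym_pos_semidef A \<longleftrightarrow> transpose A = A \<and> (\<forall>y. y \<bullet> (A *v y) \<ge> 0)"

definition msqrt :: "real^'m^'m \<Rightarrow> real^'m^'m" where
  "msqrt A = (THE B. sym_pos_semidef B \<and> B ** B = A)"

definition is_pseudo_inverse :: "real^'n^'m \<Rightarrow> real^'m^'n \<Rightarrow> bool" where
  "is_pseudo_inverse A X \<longleftrightarrow>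
     A ** X ** A = A \<and> X ** A ** X = X \<and>
     transpose (A ** X) = A ** X \<and> transpose (X ** A) = X ** A"

definition pseudo_inverse :: "real^'n^'m \<Rightarrow> real^'m^'n" where
  "pseudo_inverse A = (THE X. is_pseudo_inverse A X)"

definition block_diagonal :: "real^('n::finite \<times> six)^('n \<times> six) \<Rightarrow> bool" where
  "block_diagonal A \<longleftrightarrow> (\<forall>i j k l. i \<noteq> j \<longrightarrow> A $ (i, k) $ (j, l) = 0)"

definition skew :: "real^3 \<Rightarrow> real^3^3" where
  "skew a = matrix (\<lambda>b. cross3 a b)"

lemma skew_mult: "skew a *v b = cross3 a b"
proof -
  have "linear (cross3 a)"
    by (rule linearI) (simp_all add: cross_add_right cross_mult_right)
  then show ?thesis
    by (simp add: skew_def matrix_works matrix_vector_mul_linear)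
qed

definition proj_orth :: "real^'m \<Rightarrow> real^'m^'m" where
  "proj_orth y = mat 1 - (1 / (norm y)\<^sup>2) *\<^sub>R (\<chi> i j. y $ i * y $ j)"

definition join6 :: "'a^3 \<Rightarrow> 'a^3 \<Rightarrow> 'a^six" where
  "join6 a b = (\<chi> k. case k of Inl l \<Rightarrow> a $ l | Inr l \<Rightarrow> b $ l)"

definition hblock :: "real^3^3 \<Rightarrow> real^3^3 \<Rightarrow> real^six^3" where
  "hblock A B = (\<chi> r. join6 (A $ r) (B $ r))"

definition vblock :: "real^six^3 \<Rightarrow> real^six^3 \<Rightarrow> real^six^six" where
  "vblock A B = join6 A B"

definition agent_block :: "real^('n::finite \<times> six) \<Rightarrow> 'n \<Rightarrow> real^six" where
  "agent_block v i = (\<chi> k. v $ (i, k))"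

definition lin :: "real^six \<Rightarrow> real^3" where
  "lin w = (\<chi> l. w $ Inl l)"

definition ang :: "real^six \<Rightarrow> real^3" where
  "ang w = (\<chi> l. w $ Inr l)"


subsection \<open>Configurations and grasp matrix\<close>

abbreviation pos :: "'n config \<Rightarrow> 'n \<Rightarrow> real^3" where
  "pos x i \<equiv> fst (x i)"

abbreviation rot :: "'n config \<Rightarrow> 'n \<Rightarrow> real^3^3" where
  "rot x i \<equiv> snd (x i)"

definition configurations :: "'n config set" where
  "configurations = {x. (\<forall>i. rotation_matrix (rot x i)) \<and> inj (pos x)}"

definition object_jacobian :: "real^3 \<Rightarrow> 'n config \<Rightarrow> 'n \<Rightarrow> real^six^six" where
  "object_jacobian pO x i =
     vblock (hblock (mat 1) (- skew (pos x i - pO)))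
            (hblock 0 (mat 1))"

definition grasp_matrix :: "real^3 \<Rightarrow> 'n::finite config \<Rightarrow> real^('n \<times> six)^six" where
  "grasp_matrix pO x = (\<chi> r c. transpose (object_jacobian pO x (fst c)) $ r $ snd c)"


subsection \<open>Rigidity matrix of the complete graph\<close>

typedef ('n::card2) edge = "{(i, j). (i::'n) \<noteq> j}"
proof -
  have "\<exists>i j :: 'n. i \<noteq> j"
  proof (rule ccontr)
    assume "\<not> ?thesis"
    then have "(UNIV :: 'n set) = {undefined}" by blast
    then have "CARD('n) = card {undefined :: 'n}" by (rule arg_cong)
    then show False using one_less_card[where 'a = 'n] by simp
  qed
  then show ?thesis by auto
qed

typedef (overloaded) ('n::"{card2, linorder}") uedge = "{(i, j). (i::'n) < j}"
proof -
  obtain i j :: 'n where "i \<noteq> j"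
    using Rep_edge[of undefined] by auto
  then have "i < j \<or> j < i" by (rule linorder_class.neq_iff[THEN iffD1])
  then show ?thesis by auto
qed

instance edge :: (card2) finite
proof
  have "inj (Rep_edge :: 'a edge \<Rightarrow> 'a \<times> 'a)"
    by (simp add: inj_def Rep_edge_inject)
  then show "finite (UNIV :: 'a edge set)"
    by (rule finite_imageD[rotated]) (rule finite)
qed

instance uedge :: ("{card2, linorder}") finite
proof
  have "inj (Rep_uedge :: 'a uedge \<Rightarrow> 'a \<times> 'a)"
    by (simp add: inj_def Rep_uedge_inject)
  then show "finite (UNIV :: 'a uedge set)"
    by (rule finite_imageD[rotated]) (rule finite)
qed

type_synonym 'n constraint = "'n uedge + 'n edge \<times> 3"

definition bearing :: "'n config \<Rightarrow> 'n \<Rightarrow> 'n \<Rightarrow> real^3" where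
  "bearing x i j =
     transpose (rot x i) *v ((1 / norm (pos x i - pos x j)) *\<^sub>R (pos x j - pos x i))"

definition distance_block :: "'n config \<Rightarrow> 'n \<times> 'n \<Rightarrow> 'n \<Rightarrow> real^six" where
  "distance_block x e k =
     (let (i, j) = e in
      if k = i then join6 (pos x i - pos x j) 0
      else if k = j then join6 (pos x j - pos x i) 0
      else 0)"

definition bearing_block :: "'n config \<Rightarrow> 'n \<times> 'n \<Rightarrow> 'n \<Rightarrow> real^six^3" where
  "bearing_block x e k =
     (let (i, j) = e;
          P = ((1 / norm (pos x j - pos x i)) *\<^sub>R proj_orth (bearing x i j)) ** transpose (rot x i)
      in
      if k = i then hblock (- P) (skew (bearing x i j) ** transpose (rot x i))
      else if k = j then hblock P 0
      else 0)"

definition rigidity_matrix ::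
  "('n::{card2, linorder}) config \<Rightarrow> real^('n \<times> six)^('n constraint)" where
  "rigidity_matrix x = (\<chi> r c.
     case r of
       Inl e \<Rightarrow> distance_block x (Rep_uedge e) (fst c) $ snd c
     | Inr (e, a) \<Rightarrow> bearing_block x (Rep_edge e) (fst c) $ a $ snd c)"

definition nondegenerate :: "('n::{card2, linorder}) config \<Rightarrow> bool" where
  "nondegenerate x \<longleftrightarrow>
     rank (rigidity_matrix x)
       = Max ((\<lambda>y. rank (rigidity_matrix y)) ` (configurations :: 'n config set))"

end

theory Submission
  imports Defs
begin

text \<open>
  Differentiating \<open>\<R> v = 0\<close>, which holds because \<open>v = G\<^sup>T v\<^sub>O\<close> is a rigid motion, and eliminating the acceleration
  gives \<open>\<R>' v + \<R> \<alpha> = \<R> M\<^sup>-\<^sup>1 h\<close>. With \<open>S = M\<^sup>1\<^sup>/\<^sup>2\<close> and \<open>A = \<R> S\<^sup>-\<^sup>1\<close> this yields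
  \<open>h\<^sub>i\<^sub>n\<^sub>t = S (A\<^sup>\<dagger> A) S\<^sup>-\<^sup>1 h\<close>, where \<open>A\<^sup>\<dagger> A\<close> is the orthogonal projection with kernel \<open>ker A = S (ker \<R>)\<close>.
  If \<open>ker \<R>\<close> is the range of \<open>G\<^sup>T\<close>, that projection is \<open>1 - S G\<^sup>T (G M G\<^sup>T)\<^sup>-\<^sup>1 G S\<close>.

  The range of \<open>G\<^sup>T\<close> is always a six-dimensional subspace of \<open>ker \<R>\<close>. As nondegeneracy makes the dimension
  of \<open>ker \<R>\<close> minimal, equality follows once a single configuration has a six-dimensional kernel, and any
  configuration with no three positions collinear does.
\<close>

declare transpose_matrix_vector [simp del]

subsection \<open>Square roots of positive semidefinite matrices\<close>

text \<open>First-order optimality condition: near \<open>t = 0\<close> the linear term dominates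
  the quadratic one, so a nonzero \<open>a\<close> would make the expression positive for a suitable
  small \<open>t\<close>.\<close>

lemma linear_coefficient_zero:
  fixes a b :: real
  assumes "\<And>t. a * t + b * t\<^sup>2 \<le> 0"
  shows "a = 0"
proof (rule ccontr)
  assume "a \<noteq> 0"
  \<comment> \<open>This \<open>t\<close> has the sign of \<open>a\<close> and is scaled so that
    \<open>b + d > 0\<close>, which makes the value a positive multiple of
    \<open>b + d\<close>.\<close>
  define d t where "d = \<bar>b\<bar> + 1" and "t = a / d"
  have "d > 0" "b + d > 0"
    by (auto simp: d_def)
  then have "a * t + b * t\<^sup>2 = a\<^sup>2 * (b + d) / d\<^sup>2"
    by (simp add: t_def power2_eq_square field_simps)
  moreover have "\<dots> > 0"
    using \<open>a \<noteq> 0\<close> \<open>d > 0\<close> \<open>b + d > 0\<close> by (intro divide_pos_pos mult_pos_pos) auto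
  ultimately show False
    using assms[of t] by linarith
qed

text \<open>Rayleigh quotient argument: perturb the maximiser \<open>u\<close> in the direction of
  its own residual \<open>w = f u - c u\<close>, which lies in \<open>S\<close> by invariance. The
  first-order change is \<open>2 (w \<bullet> w)\<close>, and maximality forces it to
  vanish.\<close>

lemma self_adjoint_max_eigenvector:
  fixes f :: "'a::euclidean_space \<Rightarrow> 'a"
  assumes "linear f" and sa: "\<And>x y. f x \<bullet> y = x \<bullet> f y"
    and S: "subspace S" "f ` S \<subseteq> S"
    and u: "u \<in> S" "norm u = 1" and max: "\<And>y. y \<in> S \<Longrightarrow> norm y = 1 \<Longrightarrow> y \<bullet> f y \<le> u \<bullet> f u"
  shows "f u = (u \<bullet> f u) *\<^sub>R u"
proof -
  interpret linear f by fact
  define c w where "c = u \<bullet> f u" and "w = f u - c *\<^sub>R u"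
  \<comment> \<open>Homogeneity carries the bound from the unit sphere to all of \<open>S\<close>,
    so the perturbed vector need not be normalised.\<close>
  have le: "y \<bullet> f y \<le> c * (y \<bullet> y)" if "y \<in> S" for y
  proof (cases "y = 0")
    case False
    have "(inverse (norm y) *\<^sub>R y) \<bullet> f (inverse (norm y) *\<^sub>R y) \<le> c"
      unfolding c_def using that False S(1) by (intro max) (auto simp: subspace_scale)
    then have "(y \<bullet> f y) / (norm y)\<^sup>2 \<le> c"
      by (simp add: scale divide_inverse power2_eq_square mult_ac)
    then show ?thesis
      using False by (simp add: divide_le_eq power2_norm_eq_inner)
  qed (simp add: zero)
  have uu: "u \<bullet> u = 1"
    using u(2) by (simp add: norm_eq_1)
  have wu: "w \<bullet> u = 0"
    by (simp add: w_def inner_diff_left c_def uu inner_commute[of "f u"])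
  have wf: "w \<bullet> f u = w \<bullet> w"
    using wu by (simp add: w_def inner_diff_right)
  have "w \<in> S"
    using S u(1) by (auto simp: w_def intro!: subspace_diff subspace_scale)
  have "2 * (w \<bullet> w) * t + (w \<bullet> f w - c * (w \<bullet> w)) * t\<^sup>2 \<le> 0" for t
  proof -
    have "u + t *\<^sub>R w \<in> S"
      using S u(1) \<open>w \<in> S\<close> by (auto intro!: subspace_add subspace_scale)
    from le[OF this] have "c + 2 * t * (w \<bullet> f u) + t\<^sup>2 * (w \<bullet> f w) \<le> c * (1 + t\<^sup>2 * (w \<bullet> w))"
      using sa[of u w] wu uu
      by (simp add: add scale inner_add_left inner_add_right c_def power2_eq_square algebra_simps inner_commute)
    then show ?thesis
      by (simp add: wf algebra_simps)
  qed
  then have "2 * (w \<bullet> w) = 0"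
    by (rule linear_coefficient_zero)
  then show ?thesis
    by (simp add: w_def c_def)
qed

text \<open>Induction on the dimension: compactness of the unit sphere of \<open>S\<close> supplies
  a maximiser \<open>u\<close> of the Rayleigh quotient, and self-adjointness makes the orthogonal
  complement of \<open>u\<close> in \<open>S\<close> invariant again.\<close>

lemma self_adjoint_orthonormal_eigenbasis:
  fixes f :: "'a::euclidean_space \<Rightarrow> 'a"
  assumes "linear f" and sa: "\<And>x y. f x \<bullet> y = x \<bullet> f y"
    and "subspace S" "f ` S \<subseteq> S"
  shows "\<exists>B. B \<subseteq> S \<and> pairwise orthogonal B \<and> (\<forall>b\<in>B. norm b = 1 \<and> (\<exists>c. f b = c *\<^sub>R b)) \<and> span B = S"
  using assms(3,4)
proof (induction "dim S" arbitrary: S rule: less_induct)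
  case (less S)
  interpret linear f by fact
  show ?case
  proof (cases "S = {0}")
    case True
    then show ?thesis by (intro exI[of _ "{}"]) auto
  next
    case False
    let ?K = "S \<inter> sphere 0 1"
    have "compact ?K"
      using less.prems(1) by (intro closed_Int_compact closed_subspace) auto
    moreover obtain y where "y \<in> S" "y \<noteq> 0"
      using False less.prems(1) subspace_0 by blast
    then have "inverse (norm y) *\<^sub>R y \<in> ?K"
      using less.prems(1) by (auto simp: subspace_scale)
    moreover have "continuous_on ?K (\<lambda>x. x \<bullet> f x)"
      using \<open>linear f\<close> by (intro continuous_intros linear_continuous_on) (simp add: linear_linear)
    ultimately obtain u where "u \<in> ?K" and max: "\<And>y. y \<in> ?K \<Longrightarrow> y \<bullet> f y \<le> u \<bullet> f u"
      using continuous_attains_sup[of ?K "\<lambda>x. x \<bullet> f x"] by blast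
    then have u: "u \<in> S" "norm u = 1" by auto
    define c where "c = u \<bullet> f u"
    have fu: "f u = c *\<^sub>R u"
      unfolding c_def
      using max by (intro self_adjoint_max_eigenvector[OF \<open>linear f\<close> sa less.prems u]) auto
    define S' where "S' = {x \<in> S. u \<bullet> x = 0}"
    have S': "subspace S'" "S' \<subseteq> S"
      using less.prems(1) by (auto simp: S'_def subspace_def inner_add_right)
    have "f x \<in> S'" if "x \<in> S'" for x
      using that less.prems(2) sa[of u x] by (auto simp: S'_def fu)
    then have inv: "f ` S' \<subseteq> S'" by blast
    have "u \<notin> S'"
      using u(2) by (auto simp: S'_def)
    then have "S' \<subset> S"
      using S'(2) u(1) by blast
    then have "dim S' < dim S"
      using S'(1) less.prems(1) by (metis dim_psubset span_eq_iff)
    from less.hyps[OF this S'(1) inv] obtain B where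
      B: "B \<subseteq> S'" "pairwise orthogonal B" "\<And>b. b \<in> B \<Longrightarrow> norm b = 1 \<and> (\<exists>c. f b = c *\<^sub>R b)" "span B = S'"
      by blast
    have "x \<in> span (insert u B)" if "x \<in> S" for x
    proof -
      have "x - (u \<bullet> x) *\<^sub>R u \<in> span B"
        using that u less.prems(1) B(4)
        by (auto simp: S'_def inner_diff_right norm_eq_1 intro!: subspace_diff subspace_scale)
      then show ?thesis
        by (auto simp: span_insert)
    qed
    moreover have "span (insert u B) \<subseteq> S"
      using B(1) S'(2) u(1) less.prems(1) by (intro span_minimal) auto
    moreover have "pairwise orthogonal (insert u B)"
      using B(1,2) by (auto simp: pairwise_insert orthogonal_def S'_def inner_commute)
    ultimately show ?thesis
      using B(1,3) S'(2) u fu by (intro exI[of _ "insert u B"]) auto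
  qed
qed

section \<open>Symmetric matrices, orthonormal expansions and orthogonal projectors\<close>

lemma symmetric_matrix_inner:
  fixes A :: "real^'m^'m"
  assumes "transpose A = A"
  shows "(A *v x) \<bullet> y = x \<bullet> (A *v y)"
  by (metis assms dot_lmul_matrix transpose_matrix_vector)

lemma symmetric_matrixI:
  fixes A :: "real^'m^'m"
  assumes "\<And>x y. (A *v x) \<bullet> y = x \<bullet> (A *v y)"
  shows "transpose A = A"
proof -
  have "(transpose A *v x - A *v x) \<bullet> y = 0" for x y
    using assms[of x y] by (simp add: inner_diff_left dot_lmul_matrix transpose_matrix_vector)
  then show ?thesis
    by (metis inner_eq_zero_iff eq_iff_diff_eq_0 matrix_eq)
qed

lemma orthonormal_expansion:
  fixes B :: "'a::euclidean_space set"
  assumes "pairwise orthogonal B" "\<And>b. b \<in> B \<Longrightarrow> norm b = 1"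
  shows "finite B"
    and "x \<in> span B \<Longrightarrow> (\<Sum>b\<in>B. (x \<bullet> b) *\<^sub>R b) = x"
proof -
  show fin: "finite B"
    using assms(1) by (rule pairwise_orthogonal_imp_finite)
  assume "x \<in> span B"
  then show "(\<Sum>b\<in>B. (x \<bullet> b) *\<^sub>R b) = x"
  proof (induction rule: span_induct_alt)
    case (step c b y)
    have "(\<Sum>a\<in>B. (b \<bullet> a) *\<^sub>R a) = (\<Sum>a\<in>B. if a = b then b else 0)"
    proof (rule sum.cong)
      fix a assume "a \<in> B"
      then show "(b \<bullet> a) *\<^sub>R a = (if a = b then b else 0)"
        using assms step(1) by (auto simp: pairwise_def orthogonal_def norm_eq_1)
    qed simp
    also have "\<dots> = b"
      using fin step(1) by simp
    finally show ?case
      using step by (simp add: inner_add_left scaleR_add_left sum.distrib scaleR_sum_right[symmetric] flip: scaleR_scaleR)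
  qed simp
qed

text \<open>For orthonormal \<open>B\<close> this is the map diagonal in \<open>B\<close> with
  entries \<open>s\<close>: the constant 1 gives the orthogonal projector onto
  \<open>span B\<close>, and roots of eigenvalues give the square root of a matrix.\<close>

lemma linear_diagonal: "linear (\<lambda>x. \<Sum>b\<in>B. (x \<bullet> b * s b) *\<^sub>R b)"
  by (rule linearI) (simp_all add: inner_add_left algebra_simps sum.distrib scaleR_sum_right)

lemma orthogonal_projector_exists:
  fixes S :: "(real^'m) set"
  assumes "subspace S"
  shows "\<exists>P::real^'m^'m. transpose P = P \<and> (\<forall>x. P *v x \<in> S) \<and> (\<forall>x\<in>S. P *v x = x)"
proof -
  obtain B where B: "B \<subseteq> S" "pairwise orthogonal B" "\<And>b. b \<in> B \<Longrightarrow> norm b = 1" "span B = S"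
    using orthonormal_basis_subspace[OF assms] by blast
  define P where "P = matrix (\<lambda>x. \<Sum>b\<in>B. (x \<bullet> b * 1) *\<^sub>R b)"
  have P: "P *v x = (\<Sum>b\<in>B. (x \<bullet> b) *\<^sub>R b)" for x
    using linear_diagonal[where B = B and s = "\<lambda>_. 1"]
    by (simp add: P_def matrix_works)
  have "transpose P = P"
    by (rule symmetric_matrixI) (simp add: P inner_sum_left inner_sum_right inner_commute mult.commute)
  moreover have "P *v x \<in> S" for x
    using B(1) assms by (auto simp: P intro!: subspace_sum subspace_scale)
  moreover have "P *v x = x" if "x \<in> S" for x
    using orthonormal_expansion(2)[OF B(2,3)] that B(4) by (simp add: P)
  ultimately show ?thesis by blast
qed

section \<open>Existence and uniqueness of the square root\<close>

text \<open>Diagonalise \<open>A\<close> in an orthonormal eigenbasis and take roots of the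
  eigenvalues, which are nonnegative because \<open>c b = b \<bullet> (A *v b)\<close>.\<close>

lemma psd_sqrt_exists:
  assumes "sym_pos_semidef A"
  shows "\<exists>B. sym_pos_semidef B \<and> B ** B = A"
proof -
  have sym: "transpose A = A" and pos: "\<And>y. y \<bullet> (A *v y) \<ge> 0"
    using assms by (auto simp: sym_pos_semidef_def)
  obtain E where E: "pairwise orthogonal E" "\<And>b. b \<in> E \<Longrightarrow> norm b = 1"
      "\<And>b. b \<in> E \<Longrightarrow> \<exists>c. A *v b = c *\<^sub>R b" "span E = UNIV"
    using self_adjoint_orthonormal_eigenbasis[of "(*v) A" UNIV] symmetric_matrix_inner[OF sym]
    by auto
  obtain c where c: "\<And>b. b \<in> E \<Longrightarrow> A *v b = c b *\<^sub>R b"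
    using E(3) by metis
  have c0: "c b \<ge> 0" if "b \<in> E" for b
    using pos[of b] c[OF that] E(2)[OF that] by (simp add: norm_eq_1)
  note fin = orthonormal_expansion(1)[OF E(1,2)]
  note ex = orthonormal_expansion(2)[OF E(1,2), unfolded E(4), OF _ UNIV_I]
  define B where "B = matrix (\<lambda>x. \<Sum>b\<in>E. (x \<bullet> b * sqrt (c b)) *\<^sub>R b)"
  have B: "B *v x = (\<Sum>b\<in>E. (x \<bullet> b * sqrt (c b)) *\<^sub>R b)" for x
    using linear_diagonal[where B = E and s = "\<lambda>b. sqrt (c b)"] by (simp add: B_def matrix_works)
  have Bb: "B *v b = sqrt (c b) *\<^sub>R b" if "b \<in> E" for b
  proof -
    have "B *v b = (\<Sum>a\<in>E. if a = b then sqrt (c b) *\<^sub>R b else 0)"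
      unfolding B
      by (rule sum.cong) (use E(1,2) that in \<open>auto simp: pairwise_def orthogonal_def norm_eq_1\<close>)
    then show ?thesis using fin that by simp
  qed
  have "(B ** B) *v x = A *v x" for x
  proof -
    have "(B ** B) *v x = (B ** B) *v (\<Sum>b\<in>E. (x \<bullet> b) *\<^sub>R b)"
      using ex by simp
    also have "\<dots> = (\<Sum>b\<in>E. (x \<bullet> b) *\<^sub>R (B *v (B *v b)))"
      by (simp add: linear_sum[OF matrix_vector_mul_linear] matrix_vector_mult_scaleR matrix_vector_mul_assoc)
    also have "\<dots> = (\<Sum>b\<in>E. (x \<bullet> b) *\<^sub>R (A *v b))"
      by (rule sum.cong) (auto simp: Bb c c0 matrix_vector_mult_scaleR)
    also have "\<dots> = A *v (\<Sum>b\<in>E. (x \<bullet> b) *\<^sub>R b)"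
      by (simp add: linear_sum[OF matrix_vector_mul_linear] matrix_vector_mult_scaleR)
    finally show ?thesis using ex by simp
  qed
  moreover have "transpose B = B"
    by (rule symmetric_matrixI) (simp add: B inner_sum_left inner_sum_right inner_commute mult_ac)
  moreover have "y \<bullet> (B *v y) \<ge> 0" for y
    unfolding B inner_sum_right
  proof (rule sum_nonneg)
    fix b assume "b \<in> E"
    then have "(y \<bullet> b)\<^sup>2 * sqrt (c b) \<ge> 0"
      using c0 by simp
    then show "y \<bullet> ((y \<bullet> b * sqrt (c b)) *\<^sub>R b) \<ge> 0"
      by (simp add: power2_eq_square mult_ac)
  qed
  ultimately show ?thesis
    by (auto simp: sym_pos_semidef_def matrix_eq)
qed

text \<open>\<open>B\<^sup>2 b = \<mu>\<^sup>2 b\<close> factors as \<open>(B + \<mu>) (B - \<mu>) b = 0\<close>, and \<open>B + \<mu>\<close> is injective when \<open>\<mu> > 0\<close>.\<close>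
lemma psd_sqrt_eigenvector:
  assumes B: "sym_pos_semidef B" and "\<mu> \<ge> 0" and eq: "B *v (B *v b) = \<mu>\<^sup>2 *\<^sub>R b"
  shows "B *v b = \<mu> *\<^sub>R b"
proof (cases "\<mu> = 0")
  case True
  \<comment> \<open>When \<open>\<mu>\<close> is 0 the factorisation gives nothing; instead symmetry
    turns the squared norm of \<open>B *v b\<close> into \<open>b \<bullet> (B *v (B *v b))\<close>,
    which is 0.\<close>
  have "(B *v b) \<bullet> (B *v b) = b \<bullet> (B *v (B *v b))"
    using B by (intro symmetric_matrix_inner) (simp add: sym_pos_semidef_def)
  then show ?thesis
    using True eq by simp
next
  case False
  define w where "w = B *v b - \<mu> *\<^sub>R b"
  have "B *v w = - \<mu> *\<^sub>R w"
    by (simp add: w_def matrix_vector_mult_diff_distrib matrix_vector_mult_scaleR eq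
        algebra_simps power2_eq_square)
  then have "- \<mu> * (w \<bullet> w) \<ge> 0"
    using B by (metis inner_scaleR_right sym_pos_semidef_def)
  then have "w = 0"
    using False \<open>\<mu> \<ge> 0\<close> inner_ge_zero[of w] by (simp add: mult_le_0_iff antisym)
  then show ?thesis by (simp add: w_def)
qed

text \<open>An eigenvector of \<open>C\<close> for \<open>c\<close> satisfies
  \<open>B *v (B *v b) = c^2 b\<close>, hence is an eigenvector of \<open>B\<close> for the same
  \<open>c\<close>. Such vectors span the space.\<close>

lemma psd_sqrt_unique:
  assumes B: "sym_pos_semidef B" and C: "sym_pos_semidef C" and eq: "B ** B = C ** C"
  shows "B = C"
proof -
  have sym: "transpose C = C" and pos: "\<And>y. y \<bullet> (C *v y) \<ge> 0"
    using C by (auto simp: sym_pos_semidef_def)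
  obtain E where E: "pairwise orthogonal E" "\<And>b. b \<in> E \<Longrightarrow> norm b = 1"
      "\<And>b. b \<in> E \<Longrightarrow> \<exists>c. C *v b = c *\<^sub>R b" "span E = UNIV"
    using self_adjoint_orthonormal_eigenbasis[of "(*v) C" UNIV] symmetric_matrix_inner[OF sym]
    by auto
  have "B *v b = C *v b" if "b \<in> E" for b
  proof -
    obtain c where c: "C *v b = c *\<^sub>R b" using E(3) \<open>b \<in> E\<close> by blast
    have "c \<ge> 0"
      using pos[of b] E(2)[OF that] by (simp add: c norm_eq_1)
    have "B *v (B *v b) = c\<^sup>2 *\<^sub>R b"
      using eq by (simp add: matrix_vector_mul_assoc c power2_eq_square matrix_vector_mult_scaleR
          flip: matrix_vector_mul_assoc[of C C])
    then show ?thesis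
      using psd_sqrt_eigenvector[OF B \<open>c \<ge> 0\<close>] c by simp
  qed
  then have "B *v x = C *v x" for x
    using linear_eq_on_span[of "(*v) B" "(*v) C" E x] E(4) by auto
  then show ?thesis by (simp add: matrix_eq)
qed

lemma msqrt:
  assumes "sym_pos_semidef A"
  shows "sym_pos_semidef (msqrt A)" and "msqrt A ** msqrt A = A"
proof -
  have "\<exists>!B. sym_pos_semidef B \<and> B ** B = A"
    using psd_sqrt_exists[OF assms] psd_sqrt_unique by blast
  from theI'[OF this] show "sym_pos_semidef (msqrt A)" and "msqrt A ** msqrt A = A"
    by (simp_all add: msqrt_def)
qed

subsection \<open>Pseudo-inverses\<close>

text \<open>\<open>A\<close> maps the orthogonal complement of its kernel bijectively onto its
  range. \<open>X\<close> first projects orthogonally onto the range and then inverts that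
  bijection, so \<open>X ** A\<close> and \<open>A ** X\<close> are the two orthogonal projectors
  \<open>P\<close> and \<open>Q\<close>.\<close>

lemma pseudo_inverse_exists: "\<exists>X. is_pseudo_inverse A X"
  for A :: "real^'n^'m"
proof -
  let ?K = "{v. A *v v = 0}"
  have "subspace ?K" 
    by (auto simp: subspace_def matrix_vector_right_distrib matrix_vector_mult_scaleR)
  then obtain P0 where P0: "transpose P0 = P0" "\<And>x. A *v (P0 *v x) = 0" "\<And>x. A *v x = 0 \<Longrightarrow> P0 *v x = x"
    using orthogonal_projector_exists[of ?K] by auto
  \<comment> \<open>The orthogonal projector onto the complement of the kernel.\<close>
  define P where "P = mat 1 - P0"
  have AP: "A *v (P *v x) = A *v x" for x
    by (simp add: P_def matrix_vector_mult_diff_rdistrib P0 matrix_vector_mult_diff_distrib)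
  have PP: "P *v (P *v x) = P *v x" for x
    by (simp add: P_def matrix_vector_mult_diff_rdistrib P0 matrix_vector_mult_diff_distrib)
  have inj: "inj_on ((*v) A) (range ((*v) P))"
  proof (rule inj_onI)
    fix x y assume xy: "x \<in> range ((*v) P)" "y \<in> range ((*v) P)" "A *v x = A *v y"
    then have "P *v (x - y) = x - y"
      using PP by (metis (no_types, lifting) imageE matrix_vector_mult_diff_distrib)
    moreover have "P *v (x - y) = 0"
      using P0(3)[of "x - y"] xy(3)
      by (metis P_def diff_self matrix_vector_mul_lid matrix_vector_mult_diff_distrib matrix_vector_mult_diff_rdistrib)
    ultimately show "x = y" by simp
  qed
  have "subspace (range ((*v) P))"
    by (simp add: linear_subspace_image)
  \<comment> \<open>A linear map on the whole codomain that inverts \<open>A\<close> on the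
    complement of the kernel; precomposing with \<open>Q\<close> below fixes its values off the
    range.\<close>
  then obtain g where g: "linear g" "\<And>x. g (A *v (P *v x)) = P *v x"
    using linear_exists_left_inverse_on[of "(*v) A" "range ((*v) P)"] inj by auto
  obtain Q where Q: "transpose Q = Q" "\<And>x. Q *v x \<in> range ((*v) A)" "\<And>x. Q *v (A *v x) = A *v x"
    using orthogonal_projector_exists[of "range ((*v) A)"] by (auto simp: linear_subspace_image)
  define X where "X = matrix g ** Q"
  have X: "X *v x = g (Q *v x)" for x
    by (simp add: X_def matrix_works g(1) flip: matrix_vector_mul_assoc)
  have XA: "X ** A = P"
    using g(2) by (simp add: matrix_eq X Q AP flip: matrix_vector_mul_assoc)
  have "A *v g (Q *v x) = Q *v x" for x
    using Q(2)[of x] AP g(2) by (metis (no_types, lifting) imageE)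
  then have AX: "A ** X = Q"
    by (simp add: matrix_eq X flip: matrix_vector_mul_assoc)
  have QQ: "Q *v (Q *v x) = Q *v x" for x
    using Q(2)[of x] Q(3) by (metis (no_types, lifting) imageE)
  have "transpose P = P"
    by (simp add: P_def P0 transpose_def vec_eq_iff mat_def) (metis P0(1) transpose_def vec_lambda_beta)
  moreover have "Q ** A = A"
    by (simp add: matrix_eq Q flip: matrix_vector_mul_assoc)
  moreover have "X ** Q = X"
    by (simp add: matrix_eq X QQ flip: matrix_vector_mul_assoc)
  then have "X ** A ** X = X"
    by (simp add: AX flip: matrix_mul_assoc)
  ultimately have "is_pseudo_inverse A X"
    by (simp add: is_pseudo_inverse_def AX XA Q(1))
  then show ?thesis ..
qed

text \<open>The Penrose conditions and transposition force \<open>A ** X = A ** Y\<close> and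
  \<open>X ** A = Y ** A\<close>; then \<open>X = X A X = Y A Y = Y\<close>.\<close>

lemma pseudo_inverse_unique:
  assumes X: "is_pseudo_inverse A X" and Y: "is_pseudo_inverse A Y"
  shows "X = Y"
proof -
  have "A ** X = (A ** Y) ** (A ** X)"
    using Y by (simp add: is_pseudo_inverse_def matrix_mul_assoc)
  also have "\<dots> = transpose ((A ** X) ** (A ** Y))"
    using X Y by (simp add: is_pseudo_inverse_def matrix_transpose_mul)
  also have "\<dots> = transpose (A ** Y)"
    using X by (simp add: is_pseudo_inverse_def matrix_mul_assoc)
  also have "\<dots> = A ** Y"
    using Y by (simp add: is_pseudo_inverse_def)
  finally have AX: "A ** X = A ** Y" .
  have "X ** A = (X ** A) ** (Y ** A)"
    using Y by (simp add: is_pseudo_inverse_def flip: matrix_mul_assoc)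
  also have "\<dots> = transpose ((Y ** A) ** (X ** A))"
    using X Y by (simp add: is_pseudo_inverse_def matrix_transpose_mul)
  also have "\<dots> = transpose (Y ** A)"
    using X by (simp add: is_pseudo_inverse_def flip: matrix_mul_assoc)
  also have "\<dots> = Y ** A"
    using Y by (simp add: is_pseudo_inverse_def)
  finally have XA: "X ** A = Y ** A" .
  have "X = X ** (A ** X)"
    using X by (simp add: is_pseudo_inverse_def matrix_mul_assoc)
  also have "\<dots> = Y ** (A ** Y)"
    by (metis AX XA matrix_mul_assoc)
  also have "\<dots> = Y"
    using Y by (simp add: is_pseudo_inverse_def matrix_mul_assoc)
  finally show ?thesis .
qed

lemma pseudo_inverse: "is_pseudo_inverse A (pseudo_inverse A)"
  unfolding pseudo_inverse_def
  by (rule theI') (use pseudo_inverse_exists pseudo_inverse_unique in blast)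

text \<open>Identifies the projector \<open>A^+ A\<close> without computing \<open>A^+\<close>: the
  conditions on \<open>Q\<close> yield \<open>Z Q = Z\<close> and \<open>Q Z = Q\<close>, where
  \<open>Z = A^+ A\<close>.\<close>

lemma pseudo_inverse_mult_self:
  fixes A :: "real^'n^'m" and Q :: "real^'n^'n"
  assumes Q: "transpose Q = Q" "\<And>x. A *v (Q *v x) = A *v x" "\<And>x. A *v x = 0 \<Longrightarrow> Q *v x = 0"
  shows "pseudo_inverse A ** A = Q"
proof -
  define Z where "Z = pseudo_inverse A ** A"
  have Z: "A ** Z = A" "transpose Z = Z"
    using pseudo_inverse[of A] by (simp_all add: Z_def is_pseudo_inverse_def matrix_mul_assoc)
  have "Z *v (Q *v x) = Z *v x" for x
    using Q(2)[of x] by (simp add: Z_def flip: matrix_vector_mul_assoc)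
  then have ZQ: "Z ** Q = Z"
    by (simp add: matrix_eq flip: matrix_vector_mul_assoc)
  have "A *v (x - Z *v x) = 0" for x
    using Z(1) by (simp add: matrix_vector_mult_diff_distrib matrix_vector_mul_assoc)
  then have "Q *v (Z *v x) = Q *v x" for x
    using Q(3)[of "x - Z *v x"] by (simp add: matrix_vector_mult_diff_distrib)
  then have "Q ** Z = Q"
    by (simp add: matrix_eq flip: matrix_vector_mul_assoc)
  \<comment> \<open>Both factors are symmetric, so transposing \<open>Q Z = Q\<close> gives
    \<open>Z Q = Q\<close>, to be compared with \<open>Z Q = Z\<close>.\<close>
  then have "transpose Q = transpose Z ** transpose Q"
    by (metis matrix_transpose_mul)
  then show ?thesis
    using ZQ Z(2) Q(1) by (simp add: Z_def)
qed

subsection \<open>Kernel of the rigidity matrix\<close>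

lemma matrix_vector_mult_minus_left: "(- A) *v x = - (A *v x)"
  for A :: "real^'n^'m"
  by (simp add: vec_eq_iff matrix_vector_mult_def sum_negf)

lemma sum_six: "(\<Sum>k\<in>UNIV. f k) = (\<Sum>l\<in>UNIV. f (Inl l)) + (\<Sum>l\<in>UNIV. f (Inr l))"
  for f :: "six \<Rightarrow> 'a::comm_monoid_add"
  by (simp add: UNIV_Plus_UNIV[symmetric] sum.Plus del: UNIV_Plus_UNIV)

lemma inner_join6: "join6 a b \<bullet> w = a \<bullet> lin w + b \<bullet> ang w"
  by (simp add: inner_vec_def sum_six join6_def lin_def ang_def)

lemma hblock_mult: "hblock A B *v w = A *v lin w + B *v ang w"
  by (simp add: vec_eq_iff matrix_vector_mul_component hblock_def inner_join6)

lemma six_eq_iff: "w = w' \<longleftrightarrow> lin w = lin w' \<and> ang w = ang w'"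
proof
  assume "lin w = lin w' \<and> ang w = ang w'"
  then have "w $ k = w' $ k" for k
    by (cases k) (auto simp: lin_def ang_def vec_eq_iff)
  then show "w = w'" by (simp add: vec_eq_iff)
qed auto

lemma lin_join6 [simp]: "lin (join6 a b) = a" and ang_join6 [simp]: "ang (join6 a b) = b"
  by (simp_all add: lin_def ang_def join6_def vec_eq_iff)

lemma agent_block_eqI:
  assumes "\<And>i. agent_block w i = agent_block w' i"
  shows "w = w'"
  using assms by (auto simp: agent_block_def vec_eq_iff)

text \<open>The transposed grasp matrix produces the velocity field of a rigid motion:
  \<open>z\<close> is the twist at \<open>p\<close>, and the cross product is the contribution of
  the lever arm.\<close>

lemma agent_block_grasp:
  fixes x :: "'n::finite config"
  shows "agent_block (transpose (grasp_matrix p x) *v z) i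
    = join6 (lin z + cross3 (ang z) (pos x i - p)) (ang z)"
proof -
  have "agent_block (transpose (grasp_matrix p x) *v z) i = object_jacobian p x i *v z"
    by (simp add: agent_block_def vec_eq_iff grasp_matrix_def matrix_vector_mult_def transpose_def)
  also have "\<dots> = join6 (hblock (mat 1) (- skew (pos x i - p)) *v z) (hblock 0 (mat 1) *v z)"
    by (auto simp: object_jacobian_def vblock_def join6_def matrix_vector_mult_def vec_eq_iff split: sum.split)
  also have "\<dots> = join6 (lin z + cross3 (ang z) (pos x i - p)) (ang z)"
    by (simp add: hblock_mult matrix_vector_mult_minus_left skew_mult cross_skew[of "pos x i - p"])
  finally show ?thesis .
qed

text \<open>This is the full row rank of the grasp matrix. The block of one agent already determines
  the twist: read off the angular part first, then the linear part.\<close>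

lemma grasp_transpose_injective:
  fixes x :: "'n::finite config"
  assumes "transpose (grasp_matrix p x) *v z = 0"
  shows "z = 0"
proof -
  have "join6 (lin z + cross3 (ang z) (pos x i - p)) (ang z) = 0" for i
    using agent_block_grasp[of p x z i] assms by (simp add: agent_block_def vec_eq_iff)
  then have *: "lin z + cross3 (ang z) (pos x i - p) = lin 0 \<and> ang z = ang 0" for i
    by (metis lin_join6 ang_join6)
  have "lin (0::real^six) = 0" "ang (0::real^six) = 0"
    by (simp_all add: lin_def ang_def vec_eq_iff)
  then show ?thesis
    using *[of undefined] by (auto simp: six_eq_iff)
qed

section \<open>Action of the rows of the rigidity matrix\<close>

lemma sum_agent_blocks:
  fixes w :: "real^('n::finite \<times> six)"
  shows "(\<Sum>c\<in>UNIV. B (fst c) $ snd c * w $ c) = (\<Sum>k\<in>UNIV. B k \<bullet> agent_block w k)"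
  by (simp add: sum.cartesian_product inner_vec_def agent_block_def split_def flip: UNIV_Times_UNIV)

lemma sum_two:
  fixes f :: "'n::finite \<Rightarrow> 'a::comm_monoid_add"
  assumes "i \<noteq> j" "\<And>k. k \<noteq> i \<Longrightarrow> k \<noteq> j \<Longrightarrow> f k = 0"
  shows "(\<Sum>k\<in>UNIV. f k) = f i + f j"
proof -
  have "(\<Sum>k\<in>UNIV. f k) = (\<Sum>k\<in>{i,j}. f k)"
    by (rule sum.mono_neutral_right) (use assms in auto)
  then show ?thesis using assms(1) by simp
qed

lemma rigidity_distance_row:
  fixes x :: "('n::{card2, linorder}) config"
  assumes "Rep_uedge e = (i, j)"
  shows "(rigidity_matrix x *v w) $ Inl e
    = (pos x j - pos x i) \<bullet> (lin (agent_block w j) - lin (agent_block w i))"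
proof -
  have "i \<noteq> j"
    using Rep_uedge[of e] assms by auto
  have "(rigidity_matrix x *v w) $ Inl e = (\<Sum>k\<in>UNIV. distance_block x (i, j) k \<bullet> agent_block w k)"
    by (simp add: matrix_vector_mult_def rigidity_matrix_def assms sum_agent_blocks)
  also have "\<dots> = distance_block x (i, j) i \<bullet> agent_block w i + distance_block x (i, j) j \<bullet> agent_block w j"
    using \<open>i \<noteq> j\<close> by (intro sum_two) (auto simp: distance_block_def)
  also have "\<dots> = (pos x j - pos x i) \<bullet> (lin (agent_block w j) - lin (agent_block w i))"
    using \<open>i \<noteq> j\<close> by (simp add: distance_block_def inner_join6 inner_diff_left inner_diff_right)
  finally show ?thesis .
qed

text \<open>The three rows of an edge are gathered into one vector, so that the bearing constraint
  can be rotated into the inertial frame as a whole.\<close>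

lemma rigidity_bearing_rows:
  fixes x :: "('n::{card2, linorder}) config"
  assumes "Rep_edge e = (i, j)"
  shows "(\<chi> a. (rigidity_matrix x *v w) $ Inr (e, a))
    = (1 / norm (pos x j - pos x i)) *\<^sub>R (proj_orth (bearing x i j)
         *v (transpose (rot x i) *v (lin (agent_block w j) - lin (agent_block w i))))
      + cross3 (bearing x i j) (transpose (rot x i) *v ang (agent_block w i))"
proof -
  have "i \<noteq> j"
    using Rep_edge[of e] assms by auto
  define P where "P = ((1 / norm (pos x j - pos x i)) *\<^sub>R proj_orth (bearing x i j)) ** transpose (rot x i)"
  let ?B = "bearing_block x (i, j)"
  have "(rigidity_matrix x *v w) $ Inr (e, a) = (?B i *v agent_block w i + ?B j *v agent_block w j) $ a" for a
  proof -
    have "(rigidity_matrix x *v w) $ Inr (e, a) = (\<Sum>k\<in>UNIV. ?B k $ a \<bullet> agent_block w k)"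
      by (simp add: matrix_vector_mult_def rigidity_matrix_def assms sum_agent_blocks[of "\<lambda>k. ?B k $ a"])
    also have "\<dots> = ?B i $ a \<bullet> agent_block w i + ?B j $ a \<bullet> agent_block w j"
      using \<open>i \<noteq> j\<close> by (intro sum_two) (auto simp: bearing_block_def)
    finally show ?thesis
      by (simp add: matrix_vector_mul_component)
  qed
  then have "(\<chi> a. (rigidity_matrix x *v w) $ Inr (e, a)) = ?B i *v agent_block w i + ?B j *v agent_block w j"
    by (simp add: vec_eq_iff)
  also have "?B i = hblock (- P) (skew (bearing x i j) ** transpose (rot x i))"
    by (simp add: bearing_block_def P_def Let_def)
  also have "?B j = hblock P 0"
    using \<open>i \<noteq> j\<close> by (simp add: bearing_block_def P_def Let_def)
  finally show ?thesis
    by (simp add: hblock_mult matrix_vector_mult_minus_left skew_mult P_def matrix_vector_mult_diff_distrib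
        scaleR_diff_right scaleR_matrix_vector_assoc flip: matrix_vector_mul_assoc)
qed

lemma proj_orth_mult: "norm y = 1 \<Longrightarrow> proj_orth y *v z = z - (y \<bullet> z) *\<^sub>R y"
proof -
  assume "norm y = 1"
  have "(\<chi> i j. y $ i * y $ j) *v z = (y \<bullet> z) *\<^sub>R y"
    by (simp add: vec_eq_iff matrix_vector_mult_def inner_vec_def sum_distrib_left mult_ac)
  then show ?thesis
    using \<open>norm y = 1\<close> by (simp add: proj_orth_def matrix_vector_mult_diff_rdistrib)
qed

section \<open>The kernel as a system of rigid-velocity equations\<close>

lemma rotation_matrix_transpose:
  fixes R :: "real^3^3"
  assumes "rotation_matrix R"
  shows "rotation_matrix (transpose R)" "R *v (transpose R *v a) = a" "transpose R *v (R *v a) = a"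
    "(transpose R *v a) \<bullet> (transpose R *v b) = a \<bullet> b"
    "norm (transpose R *v a) = norm a"
proof -
  have R: "orthogonal_matrix R" "det R = 1"
    using assms by (auto simp: rotation_matrix_def)
  show *: "rotation_matrix (transpose R)"
    using R by (simp add: rotation_matrix_def det_transpose)
  show "R *v (transpose R *v a) = a" "transpose R *v (R *v a) = a"
    using R by (simp_all add: matrix_vector_mul_assoc orthogonal_matrix_def)
  have "orthogonal_transformation ((*v) (transpose R))"
    using R by (simp add: orthogonal_transformation_matrix)
  then show "(transpose R *v a) \<bullet> (transpose R *v b) = a \<bullet> b" "norm (transpose R *v a) = norm a"
    by (auto simp: orthogonal_transformation_def orthogonal_transformation_norm)
qed

text \<open>Multiplying the bearing rows by \<open>R\<^sub>i\<close> expresses them in the inertial frame: they state that the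
  component of the relative velocity orthogonal to the edge is that of a rotation with angular velocity
  \<open>\<omega>\<^sub>i\<close>.\<close>
lemma bearing_constraint_inertial:
  fixes R :: "real^3^3" and d D \<omega> :: "real^3"
  assumes R: "rotation_matrix R" and "d \<noteq> 0" and \<gamma>: "\<gamma> = transpose R *v ((1 / norm d) *\<^sub>R d)"
  shows "(1 / norm d) *\<^sub>R (proj_orth \<gamma> *v (transpose R *v D)) + cross3 \<gamma> (transpose R *v \<omega>) = 0
    \<longleftrightarrow> D - ((d \<bullet> D) / (d \<bullet> d)) *\<^sub>R d = cross3 \<omega> d"
    (is "?L = 0 \<longleftrightarrow> ?Z = _")
proof -
  note RT = rotation_matrix_transpose[OF R]
  have "norm \<gamma> = 1"
    using \<open>d \<noteq> 0\<close> by (simp add: \<gamma> RT)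
  have P: "proj_orth \<gamma> *v (transpose R *v D) = transpose R *v ?Z"
    unfolding proj_orth_mult[OF \<open>norm \<gamma> = 1\<close>] unfolding \<gamma> RT
    by (simp add: matrix_vector_mult_diff_distrib matrix_vector_mult_scaleR dot_square_norm power2_eq_square)
  have X: "cross3 \<gamma> (transpose R *v \<omega>) = transpose R *v ((1 / norm d) *\<^sub>R (- cross3 \<omega> d))"
    unfolding \<gamma> cross_rotation_matrix[OF RT(1)] by (simp add: cross_mult_left cross_skew[of d])
  have L: "?L = transpose R *v ((1 / norm d) *\<^sub>R (?Z - cross3 \<omega> d))"
    unfolding P X
    by (simp only: matrix_vector_mult_scaleR matrix_vector_right_distrib diff_conv_add_uminus scaleR_add_right)
  have "?L = 0 \<longleftrightarrow> (1 / norm d) *\<^sub>R (?Z - cross3 \<omega> d) = 0"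
    unfolding L by (metis RT(2) matrix_vector_mult_0_right)
  then show ?thesis
    using \<open>d \<noteq> 0\<close> by simp
qed

text \<open>The distance row kills the component of the relative velocity along the edge and the
  bearing rows prescribe the orthogonal one. Conversely, a cross product with the edge vector is
  orthogonal to it.\<close>

lemma rigidity_kernel_iff:
  fixes x :: "('n::{card2, linorder}) config"
  assumes "x \<in> configurations"
  shows "rigidity_matrix x *v w = 0 \<longleftrightarrow>
    (\<forall>i j. i \<noteq> j \<longrightarrow> lin (agent_block w j) - lin (agent_block w i)
        = cross3 (ang (agent_block w i)) (pos x j - pos x i))"
    (is "?K \<longleftrightarrow> (\<forall>i j. i \<noteq> j \<longrightarrow> ?D i j = cross3 (?\<omega> i) (?d i j))")
proof -
  have R: "rotation_matrix (rot x i)" for i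
    using assms by (simp add: configurations_def)
  have d: "?d i j \<noteq> 0" if "i \<noteq> j" for i j
    using assms that by (auto simp: configurations_def inj_def)
  have bearing: "(\<chi> a. (rigidity_matrix x *v w) $ Inr (e, a)) = 0
      \<longleftrightarrow> ?D i j - ((?d i j \<bullet> ?D i j) / (?d i j \<bullet> ?d i j)) *\<^sub>R ?d i j = cross3 (?\<omega> i) (?d i j)"
    if "Rep_edge e = (i, j)" for e i j
  proof -
    have "i \<noteq> j" using Rep_edge[of e] that by auto
    show ?thesis
      unfolding rigidity_bearing_rows[OF that]
      by (rule bearing_constraint_inertial[OF R d[OF \<open>i \<noteq> j\<close>]]) (simp add: bearing_def norm_minus_commute)
  qed
  show ?thesis
  proof
    assume K: ?K
    show "\<forall>i j. i \<noteq> j \<longrightarrow> ?D i j = cross3 (?\<omega> i) (?d i j)"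
    proof (intro allI impI)
      fix i j :: 'n assume "i \<noteq> j"
      then have e: "Rep_edge (Abs_edge (i, j)) = (i, j)"
        by (simp add: Abs_edge_inverse)
      have "(\<chi> a. (rigidity_matrix x *v w) $ Inr (Abs_edge (i, j), a)) = 0"
        unfolding K by (simp add: vec_eq_iff)
      then have *: "?D i j - ((?d i j \<bullet> ?D i j) / (?d i j \<bullet> ?d i j)) *\<^sub>R ?d i j = cross3 (?\<omega> i) (?d i j)"
        unfolding bearing[OF e] .
      have ordered: "?d i j \<bullet> ?D i j = 0" if "i < j" for i j
      proof -
        have "Rep_uedge (Abs_uedge (i, j)) = (i, j)"
          using that by (simp add: Abs_uedge_inverse)
        from rigidity_distance_row[OF this, of x w] K show ?thesis by simp
      qed
      \<comment> \<open>Distance rows exist only for ordered pairs; the product is symmetric in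
        \<open>i\<close> and \<open>j\<close>, so either order serves.\<close>
      have "?d i j \<bullet> ?D i j = ?d j i \<bullet> ?D j i"
        by (simp add: inner_diff_left inner_diff_right)
      then have "?d i j \<bullet> ?D i j = 0"
        using ordered[of i j] ordered[of j i] linorder_class.less_linear[of i j] \<open>i \<noteq> j\<close> by auto
      then show "?D i j = cross3 (?\<omega> i) (?d i j)"
        using * by simp
    qed
  next
    assume rigid: "\<forall>i j. i \<noteq> j \<longrightarrow> ?D i j = cross3 (?\<omega> i) (?d i j)"
    then have dist: "?d i j \<bullet> ?D i j = 0" if "i \<noteq> j" for i j
      using that by (simp add: dot_cross_self)
    have "(rigidity_matrix x *v w) $ r = 0" for r
    proof (cases r)
      case (Inl e)
      obtain i j where e: "Rep_uedge e = (i, j)" by fastforce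
      then have "i \<noteq> j" using Rep_uedge[of e] by auto
      then show ?thesis
        using dist rigidity_distance_row[OF e] Inl by simp
    next
      case (Inr ea)
      obtain e a where ea: "ea = (e, a)" by fastforce
      obtain i j where e: "Rep_edge e = (i, j)" by fastforce
      then have "i \<noteq> j" using Rep_edge[of e] by auto
      then have "(\<chi> a. (rigidity_matrix x *v w) $ Inr (e, a)) = 0"
        unfolding bearing[OF e] using dist rigid by simp
      then have "(\<chi> a. (rigidity_matrix x *v w) $ Inr (e, a)) $ a = 0"
        by simp
      then show ?thesis
        by (simp add: Inr ea)
    qed
    then show ?K by (simp add: vec_eq_iff)
  qed
qed

text \<open>In a rigid motion all angular velocities agree, and the reference point \<open>p\<close>
  cancels from relative velocities.\<close>

lemma rigidity_grasp:
  fixes x :: "('n::{card2, linorder}) config"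
  assumes "x \<in> configurations"
  shows "rigidity_matrix x *v (transpose (grasp_matrix p x) *v z) = 0"
  unfolding rigidity_kernel_iff[OF assms]
  by (simp add: agent_block_grasp Cross3.right_diff_distrib)

section \<open>Rigidity on noncollinear triangles\<close>

lemma cross_both_zero:
  fixes a b c :: "real^3"
  assumes "cross3 a b = 0" "cross3 a c = 0" "cross3 b c \<noteq> 0"
  shows "a = 0"
proof (rule ccontr)
  assume "a \<noteq> 0"
  then obtain s t where "b = s *\<^sub>R a" "c = t *\<^sub>R a"
    using assms(1,2) by (metis collinear_lemma cross_eq_0 scaleR_zero_left)
  then show False
    using assms(3) by (simp add: cross_mult_left cross_mult_right)
qed

text \<open>On each triangle \<open>ijk\<close> the relative velocities sum to zero. As \<open>\<omega>\<^sub>j - \<omega>\<^sub>k\<close> is parallel to the edge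
  \<open>jk\<close>, this leaves \<open>\<omega>\<^sub>i - \<omega>\<^sub>k\<close> parallel to both edges at \<open>i\<close>.\<close>
lemma angular_velocities_equal:
  fixes p u \<omega> :: "'n \<Rightarrow> real^3"
  assumes rigid: "\<And>i j. i \<noteq> j \<Longrightarrow> u j - u i = cross3 (\<omega> i) (p j - p i)"
    and distinct: "i \<noteq> j" "i \<noteq> k" "j \<noteq> k"
    and noncollinear: "cross3 (p j - p i) (p k - p i) \<noteq> 0"
  shows "\<omega> i = \<omega> k"
proof -
  \<comment> \<open>Compares the equations of one edge read from its two ends.\<close>
  have par: "cross3 (\<omega> a - \<omega> b) (p b - p a) = 0" if "a \<noteq> b" for a b
  proof -
    have "cross3 (\<omega> a) (p b - p a) = - cross3 (\<omega> b) (p a - p b)"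
      using rigid[OF that] rigid[OF that[symmetric]] by (metis minus_diff_eq)
    then show ?thesis
      by (simp add: Cross3.left_diff_distrib Cross3.right_diff_distrib algebra_simps)
  qed
  have "cross3 (\<omega> i) (p j - p i) + cross3 (\<omega> j) (p k - p j) + cross3 (\<omega> k) (p i - p k) = 0"
    using rigid[of i j] rigid[of j k] rigid[of k i] distinct by (simp flip: rigid)
  then have "cross3 (\<omega> i - \<omega> k) (p j - p i) + cross3 (\<omega> j - \<omega> k) (p k - p j) = 0"
    by (simp add: Cross3.left_diff_distrib Cross3.right_diff_distrib algebra_simps)
  then have "cross3 (\<omega> i - \<omega> k) (p j - p i) = 0"
    using par[OF distinct(3)] by simp
  moreover have "cross3 (\<omega> i - \<omega> k) (p k - p i) = 0"
    by (rule par[OF distinct(2)])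
  ultimately show ?thesis
    using cross_both_zero noncollinear by fastforce
qed

section \<open>Dimension count for the kernel\<close>

text \<open>The kernel is the orthogonal complement of the row space. This turns maximal rank into
  minimal kernel dimension.\<close>

lemma rank_nullity: "rank A + dim {v. A *v v = 0} = CARD('n)"
  for A :: "real^'n^'m"
proof -
  have "A *v v = 0 \<longleftrightarrow> (\<forall>r\<in>rows A. orthogonal v r)" for v
    by (auto simp: vec_eq_iff[of "A *v v"] matrix_vector_mul_component rows_def row_def orthogonal_def
        inner_commute[of v])
  then have "A *v v = 0 \<longleftrightarrow> (\<forall>r\<in>span (rows A). orthogonal r v)" for v
    by (metis orthogonal_commute orthogonal_to_span span_base)
  moreover have "dim {v \<in> UNIV. \<forall>r\<in>span (rows A). orthogonal r v} + dim (span (rows A))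
      = dim (UNIV :: (real^'n) set)"
    by (rule dim_subspace_orthogonal_to_vectors) auto
  ultimately show ?thesis
    by (simp add: row_rank_def dim_UNIV)
qed

lemma dim_grasp_range: "dim (range ((*v) (transpose (grasp_matrix p x)))) = 6"
  for x :: "'n::finite config"
proof -
  have "inj ((*v) (transpose (grasp_matrix p x)))"
  proof (rule injI)
    fix a b assume "transpose (grasp_matrix p x) *v a = transpose (grasp_matrix p x) *v b"
    then have "transpose (grasp_matrix p x) *v (a - b) = 0"
      by (simp add: matrix_vector_mult_diff_distrib)
    from grasp_transpose_injective[OF this] show "a = b" by simp
  qed
  then have "dim (range ((*v) (transpose (grasp_matrix p x)))) = dim (UNIV :: (real^six) set)"
    by (intro dim_image_eq) auto
  then show ?thesis by (simp add: dim_UNIV)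
qed

text \<open>No three points of the parabola \<open>(s, s\<^sup>2, 0)\<close> are collinear.\<close>
lemma rigid_configuration_exists:
  assumes "CARD('n::{card2, linorder}) \<ge> 3"
  shows "\<exists>y \<in> (configurations :: 'n config set). \<forall>w. rigidity_matrix y *v w = 0
    \<longrightarrow> w \<in> range ((*v) (transpose (grasp_matrix 0 y)))"
proof -
  obtain f0 :: "'n \<Rightarrow> nat" where "inj f0"
    using finite_imp_inj_to_nat_seg[of "UNIV :: 'n set"] by auto
  define f p where "f i = real (f0 i)" and "p i = (vector [f i, (f i)\<^sup>2, 0] :: real^3)" for i
  define y :: "'n config" where "y i = (p i, mat 1)" for i
  have f: "f i = f j \<longleftrightarrow> i = j" for i j
    using \<open>inj f0\<close> by (simp add: f_def inj_eq)
  have p: "p i = p j \<longleftrightarrow> i = j" for i j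
    by (metis f p_def vector_3(1))
  have y: "y \<in> configurations"
    by (auto simp: configurations_def y_def inj_def p rotation_matrix_def orthogonal_matrix_id)
  have noncoll: "cross3 (p j - p i) (p k - p i) \<noteq> 0" if "i \<noteq> j" "i \<noteq> k" "j \<noteq> k" for i j k
  proof -
    \<comment> \<open>A Vandermonde determinant in the parameters \<open>f i\<close>,
      \<open>f j\<close>, \<open>f k\<close>.\<close>
    have "cross3 (p j - p i) (p k - p i) $ 3 = (f j - f i) * (f k - f i) * (f k - f j)"
      by (simp add: p_def cross3_def vector_3 power2_eq_square algebra_simps)
    then show ?thesis
      using that f by auto
  qed
  have "w \<in> range ((*v) (transpose (grasp_matrix 0 y)))" if w: "rigidity_matrix y *v w = 0" for w
  proof -
    let ?u = "\<lambda>i. lin (agent_block w i)" and ?\<omega> = "\<lambda>i. ang (agent_block w i)"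
    have rigid: "?u j - ?u i = cross3 (?\<omega> i) (p j - p i)" if "i \<noteq> j" for i j
      using w that rigidity_kernel_iff[OF y, of w] by (simp add: y_def)
    have \<omega>: "?\<omega> i = ?\<omega> k" for i k
    proof (cases "i = k")
      case False
      \<comment> \<open>Three agents are needed here: a third vertex completes the triangle on
        \<open>i\<close> and \<open>k\<close>.\<close>
      have "card {i, k} < CARD('n)"
        using assms False by simp
      then obtain j where "j \<notin> {i, k}"
        by (metis UNIV_I card_mono finite leD subsetI)
      with False show ?thesis
        by (intro angular_velocities_equal[of ?u ?\<omega> p i j k, OF rigid] noncoll) auto
    qed simp
    define i0 where "i0 = (undefined :: 'n)"
    \<comment> \<open>The twist at the origin, the reference point of
      \<open>grasp_matrix 0 y\<close>: the velocity of agent \<open>i0\<close> is carried back along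
      its lever arm.\<close>
    define z where "z = join6 (?u i0 - cross3 (?\<omega> i0) (p i0)) (?\<omega> i0)"
    have "w = transpose (grasp_matrix 0 y) *v z"
    proof (rule agent_block_eqI)
      fix i
      have "?u i - ?u i0 = cross3 (?\<omega> i0) (p i - p i0)"
        using rigid[of i0 i] by (cases "i = i0") auto
      then have "?u i = ?u i0 - cross3 (?\<omega> i0) (p i0) + cross3 (?\<omega> i0) (p i)"
        by (simp add: Cross3.right_diff_distrib algebra_simps)
      then show "agent_block w i = agent_block (transpose (grasp_matrix 0 y) *v z) i"
        using \<omega>[of i i0] by (simp add: agent_block_grasp six_eq_iff z_def y_def)
    qed
    then show ?thesis by simp
  qed
  with y show ?thesis by blast
qed

text \<open>One inclusion always holds. For equality, maximal rank bounds the kernel dimension by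
  that of a rigid configuration, at most 6, which is the dimension of the range.\<close>

lemma rigidity_kernel_nondegenerate:
  fixes x :: "('n::{card2, linorder}) config"
  assumes "CARD('n) \<ge> 3" and x: "x \<in> configurations" "nondegenerate x"
  shows "{w. rigidity_matrix x *v w = 0} = range ((*v) (transpose (grasp_matrix p x)))"
proof -
  obtain y :: "'n config" where y: "y \<in> configurations"
      "{w. rigidity_matrix y *v w = 0} \<subseteq> range ((*v) (transpose (grasp_matrix 0 y)))"
    using rigid_configuration_exists[OF assms(1)] by blast
  have "dim {w. rigidity_matrix y *v w = 0} \<le> 6"
    using dim_subset[OF y(2)] by (simp add: dim_grasp_range)
  let ?ranks = "(\<lambda>y. rank (rigidity_matrix y)) ` (configurations :: 'n config set)"
  \<comment> \<open>Boundedness makes the set of ranks finite, so that \<open>Max\<close> really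
    dominates the rank at \<open>y\<close>.\<close>
  have "rank (rigidity_matrix z) \<le> CARD('n \<times> six)" for z :: "'n config"
    by (metis rank_nullity le_add1)
  then have "finite ?ranks"
    by (intro finite_subset[OF _ finite_atMost[of "CARD('n \<times> six)"]]) auto
  then have "rank (rigidity_matrix y) \<le> rank (rigidity_matrix x)"
    using x(2) y(1) by (simp add: nondegenerate_def)
  then have "dim {w. rigidity_matrix x *v w = 0} \<le> dim {w. rigidity_matrix y *v w = 0}"
    using rank_nullity[of "rigidity_matrix x"] rank_nullity[of "rigidity_matrix y"] by linarith
  then have le: "dim {w. rigidity_matrix x *v w = 0} \<le> dim (range ((*v) (transpose (grasp_matrix p x))))"
    using \<open>dim {w. rigidity_matrix y *v w = 0} \<le> 6\<close> by (simp add: dim_grasp_range)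
  have "range ((*v) (transpose (grasp_matrix p x))) \<subseteq> {w. rigidity_matrix x *v w = 0}"
    using rigidity_grasp[OF x(1)] by auto
  moreover have "subspace {w. rigidity_matrix x *v w = 0}"
    by (auto simp: subspace_def matrix_vector_right_distrib matrix_vector_mult_scaleR)
  ultimately show ?thesis
    using subspace_dim_equal[OF _ _ _ le] by (auto simp: linear_subspace_image)
qed

subsection \<open>Projection along the weighted range of the grasp map\<close>

lemma matrix_inv:
  fixes A :: "real^'m^'m"
  assumes "inj ((*v) A)"
  shows "matrix_inv A ** A = mat 1" "A ** matrix_inv A = mat 1"
proof -
  have "invertible A"
    using assms by (simp add: invertible_left_inverse matrix_left_invertible_injective)
  then have "A ** matrix_inv A = mat 1 \<and> matrix_inv A ** A = mat 1"
    unfolding invertible_def matrix_inv_def by (rule someI_ex)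
  then show "matrix_inv A ** A = mat 1" "A ** matrix_inv A = mat 1"
    by auto
qed

lemma inj_matrixI:
  fixes A :: "real^'n^'m"
  assumes "\<And>x. A *v x = 0 \<Longrightarrow> x = 0"
  shows "inj ((*v) A)"
proof (rule injI)
  fix x y assume "A *v x = A *v y"
  then have "A *v (x - y) = 0"
    by (simp add: matrix_vector_mult_diff_distrib)
  from assms[OF this] show "x = y" by simp
qed

lemma transpose_matrix_inv:
  fixes A :: "real^'m^'m"
  assumes "inj ((*v) A)" "transpose A = A"
  shows "transpose (matrix_inv A) = matrix_inv A"
proof -
  have "transpose (matrix_inv A) ** A = mat 1"
    by (metis assms matrix_inv(2) matrix_transpose_mul transpose_mat)
  then show ?thesis
    by (metis assms(1) matrix_inv(2) matrix_mul_assoc matrix_mul_lid matrix_mul_rid)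
qed

lemma sym_pos_def_inj:
  assumes "sym_pos_def A"
  shows "inj ((*v) A)"
proof (rule inj_matrixI)
  show "x = 0" if "A *v x = 0" for x
    using assms that unfolding sym_pos_def_def by (metis inner_zero_right less_irrefl)
qed

text \<open>Supplies the invertibility and symmetry of \<open>G M G^T\<close>.\<close>

lemma sym_pos_def_congruence:
  fixes G :: "real^'n^'m"
  assumes M: "sym_pos_def M" and G: "\<And>z. transpose G *v z = 0 \<Longrightarrow> z = 0"
  shows "sym_pos_def (G ** M ** transpose G)"
proof -
  have "z \<bullet> ((G ** M ** transpose G) *v z) > 0" if "z \<noteq> 0" for z
  proof -
    have "z \<bullet> ((G ** M ** transpose G) *v z) = (transpose G *v z) \<bullet> (M *v (transpose G *v z))"
      by (simp add: transpose_matrix_vector dot_lmul_matrix flip: matrix_vector_mul_assoc)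
    then show ?thesis
      using M G[of z] that by (auto simp: sym_pos_def_def)
  qed
  then show ?thesis
    using M by (simp add: sym_pos_def_def matrix_transpose_mul matrix_mul_assoc)
qed

lemma transpose_diff: "transpose (A - B) = transpose A - transpose B"
  by (simp add: transpose_def vec_eq_iff)

text \<open>With \<open>S\<close> the root of \<open>M\<close> and \<open>K\<close> its inverse,
  \<open>R M^-1 h\<close> is \<open>(R K) (K h)\<close>. The pseudo-inverse therefore meets
  \<open>R K\<close> and leaves a projector, conjugated by \<open>S\<close>.\<close>

lemma weighted_kernel_projection:
  fixes M :: "real^'n^'n" and R :: "real^'n^'m" and G :: "real^'n^'k"
  assumes M: "sym_pos_def M"
    and G: "\<And>z. transpose G *v z = 0 \<Longrightarrow> z = 0"
    and ker: "{w. R *v w = 0} = range ((*v) (transpose G))"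
  shows "(msqrt M ** pseudo_inverse (R ** matrix_inv (msqrt M))) *v (R *v (matrix_inv M *v h))
    = (mat 1 - M ** transpose G ** matrix_inv (G ** M ** transpose G) ** G) *v h"
proof -
  have "sym_pos_semidef M"
    using M unfolding sym_pos_def_def sym_pos_semidef_def
    by (metis inner_zero_left less_eq_real_def)
  define S where "S = msqrt M"
  have S: "transpose S = S" "S ** S = M"
    using msqrt[OF \<open>sym_pos_semidef M\<close>] by (auto simp: S_def sym_pos_semidef_def)
  have injM: "inj ((*v) M)"
    using M by (rule sym_pos_def_inj)
  have "x = 0" if "S *v x = 0" for x
  proof -
    have "M *v x = M *v 0"
      using that by (simp add: S(2)[symmetric] flip: matrix_vector_mul_assoc)
    then show ?thesis using injM by (rule injD[rotated])
  qed
  then have "inj ((*v) S)"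
    by (rule inj_matrixI)
  define K where "K = matrix_inv S"
  have K: "K ** S = mat 1" "S ** K = mat 1" "transpose K = K"
    using matrix_inv[OF \<open>inj ((*v) S)\<close>] transpose_matrix_inv[OF \<open>inj ((*v) S)\<close> S(1)] by (simp_all add: K_def)
  have KS: "K *v (S *v x) = x" "S *v (K *v x) = x" for x
    using K by (simp_all add: matrix_vector_mul_assoc)
  have "M *v (K *v (K *v x)) = x" for x
    by (simp add: S(2)[symmetric] KS flip: matrix_vector_mul_assoc)
  then have invM: "matrix_inv M *v x = K *v (K *v x)" for x
    by (metis injM matrix_inv(1) matrix_vector_mul_assoc matrix_vector_mul_lid)
  define W V where "W = G ** M ** transpose G" and "V = matrix_inv W"
  have W: "sym_pos_def W"
    unfolding W_def using M G by (rule sym_pos_def_congruence)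
  have V: "V ** W = mat 1" "transpose V = V"
    using matrix_inv[OF sym_pos_def_inj[OF W]] transpose_matrix_inv[OF sym_pos_def_inj[OF W]] W
    by (simp_all add: V_def sym_pos_def_def)
  \<comment> \<open>With \<open>B = S G^T\<close> one has \<open>B^T B = W\<close>, so
    \<open>Q\<close> is \<open>1 - B (B^T B)^-1 B^T\<close>, the orthogonal projector with kernel
    the range of \<open>B\<close>.\<close>
  define Q where "Q = mat 1 - S ** transpose G ** V ** G ** S"
  have Qv: "Q *v x = x - S *v (transpose G *v (V *v (G *v (S *v x))))" for x
    by (simp add: Q_def matrix_vector_mult_diff_rdistrib flip: matrix_vector_mul_assoc)
  have RG: "R *v (transpose G *v z) = 0" for z
    using ker by blast
  have Q: "pseudo_inverse (R ** K) ** (R ** K) = Q"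
  proof (rule pseudo_inverse_mult_self)
    show "transpose Q = Q"
      by (simp add: Q_def transpose_diff transpose_mat matrix_transpose_mul S(1) V(2) matrix_mul_assoc)
    show "(R ** K) *v (Q *v x) = (R ** K) *v x" for x
      by (simp add: Qv matrix_vector_mult_diff_distrib KS RG flip: matrix_vector_mul_assoc)
    show "Q *v x = 0" if "(R ** K) *v x = 0" for x
    proof -
      have "K *v x \<in> range ((*v) (transpose G))"
        using that by (simp add: matrix_vector_mul_assoc flip: ker)
      then obtain z where "K *v x = transpose G *v z" by blast
      then have x: "x = S *v (transpose G *v z)"
        by (metis KS(2))
      have "V *v (G *v (S *v x)) = (V ** W) *v z"
        by (simp add: x W_def S(2)[symmetric] flip: matrix_vector_mul_assoc)
      then show ?thesis
        by (simp add: Qv V(1) flip: x)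
    qed
  qed
  have "(msqrt M ** pseudo_inverse (R ** matrix_inv (msqrt M))) *v (R *v (matrix_inv M *v h))
      = S *v ((pseudo_inverse (R ** K) ** (R ** K)) *v (K *v h))"
    by (simp add: invM flip: matrix_vector_mul_assoc S_def K_def)
  also have "\<dots> = S *v (Q *v (K *v h))"
    unfolding Q ..
  also have "\<dots> = h - M *v (transpose G *v (V *v (G *v h)))"
    by (simp add: Qv matrix_vector_mult_diff_distrib KS S(2)[symmetric] flip: matrix_vector_mul_assoc)
  also have "\<dots> = (mat 1 - M ** transpose G ** V ** G) *v h"
    by (simp add: matrix_vector_mult_diff_rdistrib flip: matrix_vector_mul_assoc)
  finally show ?thesis
    by (simp add: V_def W_def)
qed

subsection \<open>Differentiability of the rigidity matrix\<close>

text \<open>Components may lie in any normed space, so a second application to the rows handles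
  matrices entry by entry.\<close>

lemma differentiable_vec_componentwise:
  fixes f :: "'a::real_normed_vector \<Rightarrow> 'b::real_normed_vector^'n"
  assumes "\<And>i. (\<lambda>s. f s $ i) differentiable F"
  shows "f differentiable F"
proof -
  have lin: "bounded_linear (axis i :: 'b \<Rightarrow> 'b^'n)" for i
  proof (rule bounded_linear_intro[where K = 1])
    show "norm (axis i x :: 'b^'n) \<le> norm x * 1" for x :: 'b
      by (simp add: norm_vec_def L2_set_def axis_def if_distrib[of norm] if_distrib[of "\<lambda>a. a\<^sup>2"] cong: if_cong)
  qed (auto simp: axis_def vec_eq_iff)
  have "(\<lambda>s. \<Sum>i\<in>UNIV. axis i (f s $ i)) differentiable F"
    using assms bounded_linear.has_derivative[OF lin]
    by (intro differentiable_sum) (auto simp: differentiable_def, blast)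
  moreover have "(\<Sum>i\<in>UNIV. axis i (f s $ i)) = f s" for s
    by (simp add: vec_eq_iff axis_def if_distrib[of "\<lambda>v. v $ _"] cong: if_cong)
  ultimately show ?thesis by simp
qed

lemma differentiable_vec_nth:
  "f differentiable F \<Longrightarrow> (\<lambda>s. f s $ i) differentiable F"
  unfolding differentiable_def by (blast intro: bounded_linear.has_derivative[OF bounded_linear_vec_nth])

lemma differentiable_linear_image:
  fixes L :: "'a::euclidean_space \<Rightarrow> 'b::real_normed_vector"
  assumes "linear L" "f differentiable F"
  shows "(\<lambda>s. L (f s)) differentiable F"
  using assms unfolding differentiable_def
  by (blast intro: bounded_linear.has_derivative[OF linear_conv_bounded_linear[THEN iffD1]])

lemma differentiable_norm:
  fixes f :: "_ \<Rightarrow> 'a::euclidean_space"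
  assumes "f differentiable (at t within T)" "f t \<noteq> 0"
  shows "(\<lambda>s. norm (f s)) differentiable (at t within T)"
  by (rule differentiable_compose[OF differentiable_norm_at[OF assms(2)] assms(1)])

lemma differentiable_matrix_vector_mult:
  fixes A :: "'a::real_normed_vector \<Rightarrow> real^'n^'m"
  assumes "A differentiable (at t within T)" "f differentiable (at t within T)"
  shows "(\<lambda>s. A s *v f s) differentiable (at t within T)"
  using assms
  by (intro differentiable_vec_componentwise)
    (simp add: matrix_vector_mul_component differentiable_inner differentiable_vec_nth)

lemma differentiable_transpose:
  fixes A :: "'a::real_normed_vector \<Rightarrow> real^'n^'m"
  assumes "A differentiable F"
  shows "(\<lambda>s. transpose (A s)) differentiable F"
  by (intro differentiable_vec_componentwise) (simp add: transpose_def differentiable_vec_nth assms)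

lemma differentiable_matrix_mult:
  fixes A :: "'a::real_normed_vector \<Rightarrow> real^'n^'m" and B :: "'a \<Rightarrow> real^'k^'n"
  assumes "A differentiable (at t within T)" "B differentiable (at t within T)"
  shows "(\<lambda>s. A s ** B s) differentiable (at t within T)"
  by (intro differentiable_vec_componentwise)
    (simp add: matrix_matrix_mult_def differentiable_vec_nth assms)

lemma differentiable_join6:
  fixes a b :: "_ \<Rightarrow> 'b::real_normed_vector^3"
  assumes "a differentiable F" "b differentiable F"
  shows "(\<lambda>s. join6 (a s) (b s)) differentiable F"
proof (rule differentiable_vec_componentwise)
  show "(\<lambda>s. join6 (a s) (b s) $ k) differentiable F" for k
    by (cases k) (simp_all add: join6_def differentiable_vec_nth assms)
qed

lemma differentiable_hblock:
  assumes "A differentiable F" "B differentiable F"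
  shows "(\<lambda>s. hblock (A s) (B s)) differentiable F"
  by (intro differentiable_vec_componentwise)
    (simp only: hblock_def vec_lambda_beta differentiable_join6 differentiable_vec_nth assms)

lemma linear_skew: "linear skew"
  by (rule linearI)
    (simp_all add: skew_def matrix_def vec_eq_iff cross_add_left cross_mult_left)

lemma differentiable_proj_orth:
  fixes y :: "_ \<Rightarrow> real^'n"
  assumes y: "y differentiable (at t within T)" "y t \<noteq> 0"
  shows "(\<lambda>s. proj_orth (y s)) differentiable (at t within T)"
proof -
  have "(\<lambda>s. (\<chi> i j. y s $ i * y s $ j)) differentiable (at t within T)"
    by (intro differentiable_vec_componentwise) (simp add: differentiable_vec_nth y)
  then show ?thesis
    unfolding proj_orth_def using y
    by (intro differentiable_diff differentiable_scaleR differentiable_divide differentiable_power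
        differentiable_norm differentiable_const) auto
qed

lemma bearing_nonzero:
  assumes "x \<in> configurations" "i \<noteq> j"
  shows "bearing x i j \<noteq> 0"
proof -
  have "rotation_matrix (rot x i)" "pos x i \<noteq> pos x j"
    using assms by (auto simp: configurations_def inj_def)
  then have "norm (bearing x i j) = 1"
    by (simp add: bearing_def rotation_matrix_transpose norm_minus_commute)
  then show ?thesis by auto
qed

text \<open>Guarantees that \<open>vector_derivative\<close> denotes an actual derivative. Only the
  norms and quotients need care: positions are distinct at \<open>t\<close>, so distances and
  bearings are nonzero there.\<close>

lemma rigidity_matrix_differentiable:
  fixes x :: "real \<Rightarrow> ('n::{card2, linorder}) config"
  assumes p: "\<And>i. (\<lambda>s. pos (x s) i) differentiable (at t within T)"
    and R: "\<And>i. (\<lambda>s. rot (x s) i) differentiable (at t within T)"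
    and x: "x t \<in> configurations"
  shows "(\<lambda>s. rigidity_matrix (x s)) differentiable (at t within T)"
proof -
  have nz: "pos (x t) i - pos (x t) j \<noteq> 0" if "i \<noteq> j" for i j
    using x that by (auto simp: configurations_def inj_def)
  have inv_norm: "(\<lambda>s. 1 / norm (pos (x s) i - pos (x s) j)) differentiable (at t within T)"
    if "i \<noteq> j" for i j
    using nz[OF that]
    by (intro differentiable_divide differentiable_const differentiable_norm differentiable_diff p) auto
  have bearing: "(\<lambda>s. bearing (x s) i j) differentiable (at t within T)" if "i \<noteq> j" for i j
    unfolding bearing_def
    by (intro differentiable_matrix_vector_mult differentiable_transpose differentiable_scaleR
        inv_norm differentiable_diff p R that)
  have dist: "(\<lambda>s. distance_block (x s) (i, j) k) differentiable (at t within T)" for i j k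
    by (cases "k = i"; cases "k = j") (simp_all add: distance_block_def differentiable_join6 p)
  have bear: "(\<lambda>s. bearing_block (x s) (i, j) k) differentiable (at t within T)" if "i \<noteq> j" for i j k
  proof -
    have "(\<lambda>s. skew (bearing (x s) i j)) differentiable (at t within T)"
      by (rule differentiable_linear_image[OF linear_skew bearing[OF that]])
    moreover have "(\<lambda>s. proj_orth (bearing (x s) i j)) differentiable (at t within T)"
      by (intro differentiable_proj_orth bearing bearing_nonzero that x)
    ultimately show ?thesis
      using inv_norm[OF that[symmetric]]
      by (cases "k = i"; cases "k = j") (simp_all add: bearing_block_def Let_def differentiable_hblock
          differentiable_matrix_mult differentiable_transpose R)
  qed
  have "(\<lambda>s. rigidity_matrix (x s) $ r $ c) differentiable (at t within T)" for r c
  proof (cases r)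
    case (Inl e)
    obtain i j where e: "Rep_uedge e = (i, j)" by fastforce
    show ?thesis
      by (simp add: rigidity_matrix_def Inl e differentiable_vec_nth dist)
  next
    case (Inr ea)
    obtain e a where ea: "ea = (e, a)" by fastforce
    obtain i j where e: "Rep_edge e = (i, j)" by fastforce
    then have "i \<noteq> j" using Rep_edge[of e] by auto
    then show ?thesis
      by (simp add: rigidity_matrix_def Inr ea e differentiable_vec_nth bear)
  qed
  then show ?thesis
    by (intro differentiable_vec_componentwise)
qed

section \<open>Differentiating a vanishing matrix-vector product\<close>

lemma bounded_bilinear_matrix_vector_mult:
  "bounded_bilinear ((*v) :: real^'n^'m \<Rightarrow> _)"
  unfolding bilinear_conv_bounded_bilinear[symmetric] bilinear_def
  by (auto intro!: linearI simp: matrix_vector_mult_add_rdistrib matrix_vector_right_distrib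
      matrix_vector_mult_scaleR scaleR_matrix_vector_assoc)

lemma derivative_matrix_vector_mult_zero:
  fixes A :: "real \<Rightarrow> real^'n^'m"
  assumes T: "is_interval T" "\<exists>a\<in>T. \<exists>b\<in>T. a < b" and t: "t \<in> T"
    and A: "A differentiable (at t within T)" and v: "(v has_vector_derivative v') (at t within T)"
    and zero: "\<And>s. s \<in> T \<Longrightarrow> A s *v v s = 0"
  shows "vector_derivative A (at t within T) *v v t + A t *v v' = 0"
proof -
  have "((\<lambda>s. A s *v v s) has_vector_derivative
      A t *v v' + vector_derivative A (at t within T) *v v t) (at t within T)"
    using A v by (intro bounded_bilinear.has_vector_derivative[OF bounded_bilinear_matrix_vector_mult])
      (auto simp: vector_derivative_works)
  moreover have "((\<lambda>s. A s *v v s) has_vector_derivative 0) (at t within T)"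
    using zero t by (subst has_vector_derivative_cong_ev[where g = "\<lambda>_. 0"]) 
      (auto simp: eventually_at_filter intro!: always_eventually)
  \<comment> \<open>Derivatives within \<open>T\<close> may be one-sided at its ends; they are
    unique because every point of a nontrivial interval is a limit point.\<close>
  moreover have "t islimpt T"
    using T t by (intro connected_imp_perfect) (auto simp: is_interval_connected_1)
  then have "at t within T \<noteq> bot"
    by (simp add: trivial_limit_within)
  ultimately have "A t *v v' + vector_derivative A (at t within T) *v v t = 0"
    by (metis vector_derivative_unique_within)
  then show ?thesis
    by (simp add: add.commute)
qed

section \<open>Internal forces along the motion\<close>

theorem theorem2:
  fixes T :: "real set"
    and x :: "real \<Rightarrow> ('n::{card2, linorder}) config"
    and v v' u h \<alpha> h_int :: "real \<Rightarrow> real^('n \<times> six)"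
    and p\<^sub>O :: "real \<Rightarrow> real^3"
    and R\<^sub>O :: "real \<Rightarrow> real^3^3"
    and v\<^sub>O v\<^sub>O' h\<^sub>O :: "real \<Rightarrow> real^six"
    and M :: "'n config \<Rightarrow> real^('n \<times> six)^('n \<times> six)"
    and C :: "'n config \<Rightarrow> real^('n \<times> six) \<Rightarrow> real^('n \<times> six)^('n \<times> six)"
    and g :: "'n config \<Rightarrow> real^('n \<times> six) \<Rightarrow> real^('n \<times> six)"
    and M\<^sub>O :: "pose \<Rightarrow> real^six^six"
    and C\<^sub>O :: "pose \<Rightarrow> real^six \<Rightarrow> real^six^six"
    and g\<^sub>O :: "pose \<Rightarrow> real^six \<Rightarrow> real^six"
  defines "x\<^sub>O \<equiv> \<lambda>t. (p\<^sub>O t, R\<^sub>O t)"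
    and "G \<equiv> \<lambda>t. grasp_matrix (p\<^sub>O t) (x t)"
    and "Rig \<equiv> \<lambda>t. rigidity_matrix (x t)"
    and "Rig' \<equiv> \<lambda>t. vector_derivative (\<lambda>s. rigidity_matrix (x s)) (at t within T)"
  assumes N: "CARD('n) \<ge> 3"
    and T: "is_interval T" "\<exists>a\<in>T. \<exists>b\<in>T. a < b"
    and config: "\<And>t. t \<in> T \<Longrightarrow> x t \<in> configurations"
    and object_config: "\<And>t. t \<in> T \<Longrightarrow> rotation_matrix (R\<^sub>O t)"
    and M: "\<And>t. t \<in> T \<Longrightarrow> sym_pos_def (M (x t)) \<and> block_diagonal (M (x t))"
    and M\<^sub>O: "\<And>t. t \<in> T \<Longrightarrow> sym_pos_def (M\<^sub>O (x\<^sub>O t))"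
    and agent_kinematics: "\<And>t i. t \<in> T \<Longrightarrow>
          ((\<lambda>s. pos (x s) i) has_vector_derivative lin (agent_block (v t) i)) (at t within T)"
        "\<And>t i. t \<in> T \<Longrightarrow>
          ((\<lambda>s. rot (x s) i) has_vector_derivative
             skew (ang (agent_block (v t) i)) ** rot (x t) i) (at t within T)"
    and object_kinematics: "\<And>t. t \<in> T \<Longrightarrow>
          (p\<^sub>O has_vector_derivative lin (v\<^sub>O t)) (at t within T)"
        "\<And>t. t \<in> T \<Longrightarrow>
          (R\<^sub>O has_vector_derivative skew (ang (v\<^sub>O t)) ** R\<^sub>O t) (at t within T)"
    and accelerations: "\<And>t. t \<in> T \<Longrightarrow> (v has_vector_derivative v' t) (at t within T)"
        "\<And>t. t \<in> T \<Longrightarrow> (v\<^sub>O has_vector_derivative v\<^sub>O' t) (at t within T)"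
    and agent_dynamics: "\<And>t. t \<in> T \<Longrightarrow>
          M (x t) *v v' t + C (x t) (v t) *v v t + g (x t) (v t) = u t - h t"
    and object_dynamics: "\<And>t. t \<in> T \<Longrightarrow>
          M\<^sub>O (x\<^sub>O t) *v v\<^sub>O' t + C\<^sub>O (x\<^sub>O t) (v\<^sub>O t) *v v\<^sub>O t + g\<^sub>O (x\<^sub>O t) (v\<^sub>O t) = h\<^sub>O t"
    and grasp_rigidity: "\<And>t. t \<in> T \<Longrightarrow> v t = transpose (G t) *v v\<^sub>O t"
    and grasp_force: "\<And>t. t \<in> T \<Longrightarrow> h\<^sub>O t = G t *v h t"
    and nondegenerate: "\<And>t. t \<in> T \<Longrightarrow> nondegenerate (x t)"
    and \<alpha>: "\<And>t. t \<in> T \<Longrightarrow>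
          \<alpha> t = matrix_inv (M (x t)) *v (u t - C (x t) (v t) *v v t - g (x t) (v t))"
    and h_int: "\<And>t. t \<in> T \<Longrightarrow>
          h_int t = (msqrt (M (x t)) ** pseudo_inverse (Rig t ** matrix_inv (msqrt (M (x t)))))
                      *v (Rig' t *v v t + Rig t *v \<alpha> t)"
  shows "\<forall>t\<in>T. h_int t =
           (mat 1 - M (x t) ** transpose (G t)
                      ** matrix_inv (G t ** M (x t) ** transpose (G t)) ** G t) *v h t"
proof
  fix t assume t: "t \<in> T"
  have ker: "Rig s *v (transpose (G s) *v z) = 0" if "s \<in> T" for s z
    unfolding Rig_def G_def by (rule rigidity_grasp[OF config[OF that]])
  have "(\<lambda>s. rigidity_matrix (x s)) differentiable (at t within T)"
    using agent_kinematics[OF t]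
    by (intro rigidity_matrix_differentiable config t) (auto intro: differentiableI_vector)
  then have "Rig' t *v v t + Rig t *v v' t = 0"
    unfolding Rig_def Rig'_def
    by (rule derivative_matrix_vector_mult_zero[OF T t _ accelerations(1)[OF t]])
      (use ker grasp_rigidity in \<open>simp add: Rig_def\<close>)
  moreover have "\<alpha> t = v' t + matrix_inv (M (x t)) *v h t"
  proof -
    have "u t - C (x t) (v t) *v v t - g (x t) (v t) = M (x t) *v v' t + h t"
      using agent_dynamics[OF t] by (simp add: algebra_simps)
    moreover have "matrix_inv (M (x t)) *v (M (x t) *v v' t) = v' t"
      using matrix_inv(1)[OF sym_pos_def_inj, of "M (x t)"] M[OF t] by (simp add: matrix_vector_mul_assoc)
    ultimately show ?thesis
      by (simp add: \<alpha>[OF t] matrix_vector_right_distrib)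
  qed
  \<comment> \<open>The unknown acceleration \<open>v'\<close> drops out, since its terms form the
    differentiated constraint; only the grasp forces remain.\<close>
  ultimately have "Rig' t *v v t + Rig t *v \<alpha> t = Rig t *v (matrix_inv (M (x t)) *v h t)"
    by (simp add: matrix_vector_right_distrib flip: add.assoc)
  then show "h_int t = (mat 1 - M (x t) ** transpose (G t)
      ** matrix_inv (G t ** M (x t) ** transpose (G t)) ** G t) *v h t"
    using weighted_kernel_projection[OF conjunct1[OF M[OF t]] grasp_transpose_injective
        rigidity_kernel_nondegenerate[OF N config[OF t] nondegenerate[OF t]]]
    by (simp add: h_int[OF t] G_def Rig_def)
qed

end
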